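(* Let $N\ge2$, $i\in\{1,\dots,N\}$, $p>1$, $R>0$, $U\in\mathrm{USC}((0,R))$ and $f\in C((0,R))$. Assume that $U$ is locally bounded in $(0,R)$ and set $u(x)=U(|x|)$ for $x\in B_R\setminus\{0\}$. Then $u$ is a viscosity subsolution of $$-\lambda_i(D^2u)+|Du|^p=f(|x|)\quad\text{in }B_R\setminus\{0\}$$ if and only if $U$ is a viscosity subsolution of $$-\bar\lambda_i(r,U'',U')+|U'|^p=f(r)\quad\text{in }(0,R),$$ where, for $(r,x,y)\in(0,+\infty)\times\mathbb{R}\times\mathbb{R}$, $$\bar\lambda_i(r,x,y)=\begin{cases}\min\{x,y/r\}&\text{if }i=1,\\ y/r&\text{if }1<i<N,\\ \max\{x,y/r\}&\text{if }i=N.\end{cases}$$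
   Context: $B_R\subset\mathbb{R}^N$ is the open ball of radius $R$ centered at $0$. For a real symmetric $N\times N$ matrix $X$, $\lambda_1(X)\le\dots\le\lambda_N(X)$ denote its eigenvalues in nondecreasing order. $\mathrm{USC}$ denotes real-valued upper semicontinuous functions. The function $u$ is a viscosity subsolution of the PDE if, whenever $\varphi$ is $C^2$ and $u-\varphi$ has a local maximum at $x\in B_R\setminus\{0\}$, one has $-\lambda_i(D^2\varphi(x))+|D\varphi(x)|^p\le f(|x|)$. The function $U$ is a viscosity subsolution of the ODE if, whenever $\phi$ is $C^2$ and $U-\phi$ has a local maximum at $r\in(0,R)$, one has $-\bar\lambda_i(r,\phi''(r),\phi'(r))+|\phi'(r)|^p\le f(r)$. *)

theory Defs
  imports "HOL-Analysis.Analysis"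
begin

definition eigenspace :: "real ^ 'n ^ 'n \<Rightarrow> real \<Rightarrow> (real ^ 'n) set" where
  "eigenspace A c = {v. A *v v = c *\<^sub>R v}"

text \<open>
  Eigenvalues in nondecreasing order, each repeated according to the dimension of its
  eigenspace. For a symmetric matrix, this multiplicity coincides with the algebraic one and
  the list has length \<open>CARD('n)\<close>. No meaning is attached to it for other matrices.
\<close>

definition sorted_eigenvalues :: "real ^ 'n ^ 'n \<Rightarrow> real list" where
  "sorted_eigenvalues A =
     concat (map (\<lambda>c. replicate (dim (eigenspace A c)) c)
                 (sorted_list_of_set {c. \<exists>v. v \<noteq> 0 \<and> A *v v = c *\<^sub>R v}))"

text \<open>The index is 1-based: \<open>ord_eigenvalue i A\<close> is $\lambda_i(A)$ for \<open>1 \<le> i \<le> CARD('n)\<close>.\<close>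

definition ord_eigenvalue :: "nat \<Rightarrow> real ^ 'n ^ 'n \<Rightarrow> real" where
  "ord_eigenvalue i A = sorted_eigenvalues A ! (i - 1)"

definition gradient :: "(real ^ 'n \<Rightarrow> real) \<Rightarrow> real ^ 'n \<Rightarrow> real ^ 'n" where
  "gradient \<phi> x = (\<chi> j. frechet_derivative \<phi> (at x) (axis j 1))"

definition hessian :: "(real ^ 'n \<Rightarrow> real) \<Rightarrow> real ^ 'n \<Rightarrow> real ^ 'n ^ 'n" where
  "hessian \<phi> x = jacobian (gradient \<phi>) (at x)"

text \<open>Both notions of class $C^2$ are meant for open sets only.\<close>

definition C2_on :: "(real ^ 'n) set \<Rightarrow> (real ^ 'n \<Rightarrow> real) \<Rightarrow> bool" where
  "C2_on S \<phi> \<longleftrightarrow>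
     (\<forall>x\<in>S. \<phi> differentiable (at x)) \<and>
     (\<forall>x\<in>S. gradient \<phi> differentiable (at x)) \<and>
     continuous_on S (hessian \<phi>)"

definition C2_real_on :: "real set \<Rightarrow> (real \<Rightarrow> real) \<Rightarrow> bool" where
  "C2_real_on S \<phi> \<longleftrightarrow>
     (\<forall>r\<in>S. \<phi> differentiable (at r)) \<and>
     (\<forall>r\<in>S. deriv \<phi> differentiable (at r)) \<and>
     continuous_on S (deriv (deriv \<phi>))"

definition usc_on :: "'a::topological_space set \<Rightarrow> ('a \<Rightarrow> real) \<Rightarrow> bool" where
  "usc_on S g \<longleftrightarrow> (\<forall>a. openin (top_of_set S) {x\<in>S. g x < a})"

definition locally_bounded_on :: "'a::topological_space set \<Rightarrow> ('a \<Rightarrow> real) \<Rightarrow> bool" where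
  "locally_bounded_on S g \<longleftrightarrow>
     (\<forall>x\<in>S. \<exists>T. openin (top_of_set S) T \<and> x \<in> T \<and> bounded (g ` T))"

definition local_max_at :: "('a::topological_space \<Rightarrow> real) \<Rightarrow> 'a \<Rightarrow> bool" where
  "local_max_at g x \<longleftrightarrow> (\<forall>\<^sub>F y in nhds x. g y \<le> g x)"

text \<open>
  For both equations below the domain is open, so a local maximum at one of its points only depends
  on the values taken inside the domain; the values of the (total) functions outside it are
  irrelevant.
\<close>

definition punctured_ball :: "real \<Rightarrow> (real ^ 'n) set" where
  "punctured_ball R = ball 0 R - {0}"

text \<open>$-\lambda_i(D^2u) + |Du|^p = f(|x|)$ in $B_R \setminus \{0\}$\<close>

definition visc_subsol_PDE ::
  "nat \<Rightarrow> real \<Rightarrow> (real \<Rightarrow> real) \<Rightarrow> real \<Rightarrow> (real ^ 'n \<Rightarrow> real) \<Rightarrow> bool" where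
  "visc_subsol_PDE i p f R u \<longleftrightarrow>
     (\<forall>\<phi>. C2_on (punctured_ball R) \<phi> \<longrightarrow>
       (\<forall>x\<in>punctured_ball R. local_max_at (\<lambda>y. u y - \<phi> y) x \<longrightarrow>
          - ord_eigenvalue i (hessian \<phi> x) + norm (gradient \<phi> x) powr p \<le> f (norm x)))"

definition lambda_bar :: "nat \<Rightarrow> nat \<Rightarrow> real \<Rightarrow> real \<Rightarrow> real \<Rightarrow> real" where
  "lambda_bar N i r x y =
     (if i = 1 then min x (y / r) else if i < N then y / r else max x (y / r))"

text \<open>$-\bar\lambda_i(r,U'',U') + |U'|^p = f(r)$ in $(0,R)$\<close>

definition visc_subsol_ODE ::
  "nat \<Rightarrow> nat \<Rightarrow> real \<Rightarrow> (real \<Rightarrow> real) \<Rightarrow> real \<Rightarrow> (real \<Rightarrow> real) \<Rightarrow> bool" where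
  "visc_subsol_ODE N i p f R U \<longleftrightarrow>
     (\<forall>\<phi>. C2_real_on {0<..<R} \<phi> \<longrightarrow>
       (\<forall>r\<in>{0<..<R}. local_max_at (\<lambda>s. U s - \<phi> s) r \<longrightarrow>
          - lambda_bar N i r (deriv (deriv \<phi>) r) (deriv \<phi> r) + \<bar>deriv \<phi> r\<bar> powr p \<le> f r))"

end

theory Submission
  imports Defs
begin

text \<open>
  Write \<open>r = norm x\<close> and \<open>e = sgn x\<close>, so that \<open>e\<close> is the radial direction at \<open>x\<close>.

  If the equation holds in the punctured ball, a test function \<open>\<phi>\<close> for \<open>U\<close> at \<open>r\<close> gives the radial test
  function \<open>\<phi> (norm x)\<close>. Its Hessian has eigenvalue \<open>\<phi>''(r)\<close> on the line of \<open>e\<close> and \<open>\<phi>'(r) / r\<close> on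
  the orthogonal hyperplane (\<open>radial_function\<close>), which is where \<open>lambda_bar\<close> comes from.

  Conversely, let \<open>\<Phi>\<close> touch the radial function from above at \<open>x\<close>, with gradient \<open>g\<close> and Hessian \<open>H\<close>
  there. On the sphere through \<open>x\<close> the radial function is constant, so \<open>\<Phi>\<close> has a local minimum there.
  Along great circles this shows that \<open>g\<close> is radial and that \<open>w \<bullet> H w \<ge> (g \<bullet> e) / r\<close> for unit vectors
  \<open>w\<close> orthogonal to \<open>e\<close> (\<open>spherical_test\<close>). Hence every eigenvalue from the second on is at
  least \<open>(g \<bullet> e) / r\<close>, and the largest is at least \<open>e \<bullet> H e\<close>. The function \<open>s \<mapsto> \<Phi> (s e)\<close> tests \<open>U\<close> at \<open>r\<close>
  with derivatives \<open>g \<bullet> e\<close> and \<open>e \<bullet> H e\<close>, and this settles all indices but the first.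

  For the smallest eigenvalue the ray is not enough, because \<open>H\<close> may mix the radial and tangential
  directions. Instead of the ray, take a curve \<open>\<gamma>\<close> with \<open>norm (\<gamma> s) = s\<close> that
  crosses the sphere through \<open>x\<close> with velocity \<open>e + b w\<close>. Then \<open>\<Phi> \<circ> \<gamma>\<close> is again a test
  function for \<open>U\<close>. Its first derivative is still \<open>g \<bullet> e\<close>, and its second derivative is
  \<open>(e + b w) \<bullet> H (e + b w) - b\<^sup>2 (g \<bullet> e) / r\<close>, where the last term is the curvature of the sphere
  (\<open>swept_curve_test\<close>). With \<open>c = \<bar>g\<bar>\<^sup>p - f r\<close>, the equation for \<open>U\<close> says that both this number and
  \<open>(g \<bullet> e) / r\<close> are at least \<open>c\<close>, so \<open>y \<bullet> H y \<ge> c (1 + b\<^sup>2) = c (y \<bullet> y)\<close> for \<open>y = e + b w\<close>. By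
  homogeneity this covers all vectors that are not tangential, and the tangential ones are covered
  by the great circles.

  Two general facts make this precise: the Hessian of a $C^2$ function is symmetric
  (\<open>hessian_symmetric\<close>), and ordered eigenvalues of a symmetric matrix are bounded by the quadratic
  form on subspaces of suitable dimension (\<open>ord_eigenvalue_ge\<close>, \<open>ord_eigenvalue_le\<close>).
\<close>

section \<open>Spectral theorem and bounds for ordered eigenvalues\<close>

text \<open>
  A maximiser \<open>v\<close> of the Rayleigh quotient on \<open>S\<close> is an eigenvector: if \<open>M\<close> is the maximum, then
  \<open>M * (w \<bullet> w) - w \<bullet> f w\<close> is nonnegative on \<open>S\<close> and vanishes at \<open>v\<close>, so its derivative at \<open>v\<close> vanishes
  in the direction of the residual \<open>f v - M v\<close>, which forces the residual to be zero.
\<close>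

lemma self_adjoint_has_eigenvector:
  fixes f :: "'a::euclidean_space \<Rightarrow> 'a"
  assumes lin: "linear f" and adj: "\<And>x y. f x \<bullet> y = x \<bullet> f y"
    and sub: "subspace S" and ne: "S \<noteq> {0}" and inv: "f ` S \<subseteq> S"
  obtains v c where "v \<in> S" "norm v = 1" "f v = c *\<^sub>R v"
proof -
  interpret f: linear f by (rule lin)
  obtain s where s: "s \<in> S" "s \<noteq> 0"
    using ne sub subspace_0 by blast
  have "(1 / norm s) *\<^sub>R s \<in> S \<inter> sphere 0 1"
    using s sub by (simp add: subspace_scale)
  then have nonempty: "S \<inter> sphere 0 1 \<noteq> {}" by blast
  have comp: "compact (S \<inter> sphere 0 1)"
    using sub by (simp add: closed_subspace closed_Int_compact)
  have "continuous_on (S \<inter> sphere 0 1) (\<lambda>v. v \<bullet> f v)"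
    by (intro continuous_intros linear_continuous_on linear_conv_bounded_linear[THEN iffD1] lin)
  then obtain v where v: "v \<in> S" "norm v = 1"
    and max: "\<And>w. w \<in> S \<Longrightarrow> norm w = 1 \<Longrightarrow> w \<bullet> f w \<le> v \<bullet> f v"
    using continuous_attains_sup[OF comp nonempty] by fastforce
  define M where "M = v \<bullet> f v"
  have bound: "w \<bullet> f w \<le> M * (w \<bullet> w)" if "w \<in> S" for w
  proof (cases "w = 0")
    case False
    define u where "u = (1 / norm w) *\<^sub>R w"
    have "u \<in> S" "norm u = 1"
      using that False sub by (simp_all add: u_def subspace_scale)
    then have "u \<bullet> f u \<le> M" using max M_def by blast
    moreover have "w = norm w *\<^sub>R u" using False by (simp add: u_def)
    then have "w \<bullet> f w = (norm w)\<^sup>2 * (u \<bullet> f u)"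
      by (metis f.scaleR inner_scaleR_left inner_scaleR_right mult.assoc power2_eq_square)
    ultimately show ?thesis
      by (simp add: power2_norm_eq_inner mult.commute[of M] mult_left_mono)
  qed (simp add: f.zero)
  define z where "z = f v - M *\<^sub>R v"
  have zS: "z \<in> S"
    using v inv sub by (auto simp: z_def intro!: subspace_diff subspace_scale)
  define K where "K = M * (z \<bullet> z) - z \<bullet> f z"
  have vv: "v \<bullet> v = 1" using v by (simp add: norm_eq_1)
  have zfv: "z \<bullet> f v = z \<bullet> z + M * (z \<bullet> v)"
    by (simp add: z_def inner_diff algebra_simps)
  (* For small t > 0 this is only possible if z vanishes. *)
  have key: "2 * t * (z \<bullet> z) \<le> t\<^sup>2 * K" for t
  proof -
    have "v + t *\<^sub>R z \<in> S" using v zS sub by (simp add: subspace_add subspace_scale)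
    note bound[OF this]
    moreover have "(v + t *\<^sub>R z) \<bullet> f (v + t *\<^sub>R z)
        = M + 2 * t * (z \<bullet> f v) + t\<^sup>2 * (z \<bullet> f z)"
      using adj[of v z] unfolding f.add f.scaleR M_def
      by (simp add: inner_add_left inner_add_right inner_commute power2_eq_square algebra_simps)
    moreover have "(v + t *\<^sub>R z) \<bullet> (v + t *\<^sub>R z) = 1 + 2 * t * (z \<bullet> v) + t\<^sup>2 * (z \<bullet> z)"
      using vv by (simp add: inner_add_left inner_add_right inner_commute power2_eq_square algebra_simps)
    ultimately have "M + 2 * t * (z \<bullet> f v) + t\<^sup>2 * (z \<bullet> f z)
        \<le> M * (1 + 2 * t * (z \<bullet> v) + t\<^sup>2 * (z \<bullet> z))" by simp
    then show ?thesis unfolding zfv K_def by (simp add: algebra_simps)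
  qed
  have "z \<bullet> z = 0"
  proof (rule ccontr)
    assume "z \<bullet> z \<noteq> 0"
    then have pos: "z \<bullet> z > 0" by simp
    have Kpos: "K > 0" using key[of 1] pos by (simp del: inner_gt_zero_iff)
    from key[of "(z \<bullet> z) / K"] have "2 * (z \<bullet> z)\<^sup>2 / K \<le> (z \<bullet> z)\<^sup>2 / K"
      using Kpos by (simp add: power2_eq_square field_simps)
    then show False using pos Kpos by (simp add: field_simps)
  qed
  then have "f v = M *\<^sub>R v" by (simp add: z_def)
  with v that show thesis by blast
qed

text \<open>
  The orthogonal complement of an eigenvector in \<open>S\<close> is again invariant, so one can split off
  eigenvectors one at a time.
\<close>

lemma self_adjoint_orthonormal_eigenbasis:
  fixes f :: "'a::euclidean_space \<Rightarrow> 'a"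
  assumes lin: "linear f" and adj: "\<And>x y. f x \<bullet> y = x \<bullet> f y"
    and "subspace S" and "f ` S \<subseteq> S"
  shows "\<exists>B. finite B \<and> pairwise orthogonal B \<and> span B = S \<and>
             (\<forall>b\<in>B. norm b = 1 \<and> f b = (b \<bullet> f b) *\<^sub>R b)"
  using assms(3,4)
proof (induction "dim S" arbitrary: S rule: less_induct)
  case less
  interpret f: linear f by (rule lin)
  show ?case
  proof (cases "S = {0}")
    case True
    then show ?thesis by (intro exI[of _ "{}"]) auto
  next
    case False
    obtain v c where v: "v \<in> S" "norm v = 1" "f v = c *\<^sub>R v"
      using self_adjoint_has_eigenvector[OF lin adj less.prems(1) False less.prems(2)] by blast
    have vv: "v \<bullet> v = 1" using v by (simp add: norm_eq_1)
    define T where "T = {x\<in>S. v \<bullet> x = 0}"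
    have subT: "subspace T"
      using less.prems(1) by (auto simp: T_def subspace_def inner_add_right)
    have "v \<notin> T" using vv by (simp add: T_def)
    then have "T \<subset> S" using v(1) unfolding T_def by blast
    then have "dim T < dim S"
      using subT less.prems(1) by (metis dim_psubset span_eq_iff)
    moreover have "f ` T \<subseteq> T"
      using less.prems(2) v(3) by (auto simp: T_def simp flip: adj)
    ultimately obtain B where B: "finite B" "pairwise orthogonal B" "span B = T"
      "\<forall>b\<in>B. norm b = 1 \<and> f b = (b \<bullet> f b) *\<^sub>R b"
      using less.hyps[of T] subT by blast
    have vB: "v \<bullet> b = 0" if "b \<in> B" for b
      using that B(3) span_base T_def by blast
    have "span (insert v B) = S"
    proof
      show "span (insert v B) \<subseteq> S"
        using v B(3) less.prems(1) span_superset[of B] by (intro span_minimal) (auto simp: T_def)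
      show "S \<subseteq> span (insert v B)"
      proof
        fix x assume x: "x \<in> S"
        have "x - (v \<bullet> x) *\<^sub>R v \<in> T"
          using x v vv less.prems(1) by (auto simp: T_def inner_diff_right subspace_diff subspace_scale)
        then show "x \<in> span (insert v B)" using B(3) span_breakdown_eq by blast
      qed
    qed
    moreover have "f v = (v \<bullet> f v) *\<^sub>R v" using v vv by simp
    moreover have "pairwise orthogonal (insert v B)"
      using B(2) vB by (auto simp: pairwise_insert orthogonal_def inner_commute)
    ultimately show ?thesis
      using B v by (intro exI[of _ "insert v B"]) auto
  qed
qed

text \<open>
  The eigenvalue of a unit eigenvector \<open>b\<close> is \<open>b \<bullet> (A *v b)\<close>; writing it this way avoids a separate
  function from basis vectors to eigenvalues.
\<close>

definition eigenbasis :: "real ^ 'n ^ 'n \<Rightarrow> (real ^ 'n) set \<Rightarrow> bool" where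
  "eigenbasis A B \<longleftrightarrow> finite B \<and> pairwise orthogonal B \<and> span B = UNIV \<and>
     (\<forall>b\<in>B. norm b = 1 \<and> A *v b = (b \<bullet> (A *v b)) *\<^sub>R b)"

lemma symmetric_matrix_eigenbasis:
  fixes A :: "real ^ 'n ^ 'n"
  assumes "transpose A = A"
  obtains B where "eigenbasis A B"
proof -
  have "(A *v x) \<bullet> y = x \<bullet> (A *v y)" for x y
    using dot_lmul_matrix[of x A y] assms by (metis vector_transpose_matrix)
  from self_adjoint_orthonormal_eigenbasis[OF matrix_vector_mul_linear this subspace_UNIV] that
  show thesis unfolding eigenbasis_def by blast
qed

lemma orthonormal_inner_sum:
  assumes "finite C" "pairwise orthogonal C" "\<forall>b\<in>C. norm b = 1"
  shows "(\<Sum>b\<in>C. u b *\<^sub>R b) \<bullet> (\<Sum>b\<in>C. w b *\<^sub>R b) = (\<Sum>b\<in>C. u b * w b)"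
proof -
  have "b \<bullet> b' = (if b' = b then 1 else 0)" if "b \<in> C" "b' \<in> C" for b b'
    using assms that by (auto simp: pairwise_def orthogonal_def norm_eq_1)
  then have "(\<Sum>b\<in>C. u b * (b \<bullet> b')) = u b'" if "b' \<in> C" for b'
    using assms(1) that by (simp add: if_distrib[of "\<lambda>t. _ * t"] cong: if_cong)
  then show ?thesis
    unfolding inner_sum_left inner_scaleR_left inner_sum_right inner_scaleR_right
    by (simp add: mult.commute)
qed

text \<open>
  Eigenbasis coordinates diagonalise the quadratic form; the span of a part of the basis is allowed
  because comparisons below concern the eigenvectors with eigenvalue on one side of a threshold.
\<close>

lemma eigenbasis_span_quadratic_form:
  assumes B: "eigenbasis A B" and "C \<subseteq> B" and "v \<in> span C"
  obtains u where "v = (\<Sum>b\<in>C. u b *\<^sub>R b)"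
    "A *v v = (\<Sum>b\<in>C. (u b * (b \<bullet> (A *v b))) *\<^sub>R b)"
    "v \<bullet> v = (\<Sum>b\<in>C. (u b)\<^sup>2)" "v \<bullet> (A *v v) = (\<Sum>b\<in>C. (u b)\<^sup>2 * (b \<bullet> (A *v b)))"
proof -
  have fin: "finite C" and orth: "pairwise orthogonal C" and unit: "\<forall>b\<in>C. norm b = 1"
    and eig: "\<And>b. b \<in> C \<Longrightarrow> A *v b = (b \<bullet> (A *v b)) *\<^sub>R b"
    using assms by (auto simp: eigenbasis_def intro: finite_subset pairwise_subset)
  obtain u where u: "v = (\<Sum>b\<in>C. u b *\<^sub>R b)"
    using assms(3) unfolding span_finite[OF fin] by auto
  have Av: "A *v v = (\<Sum>b\<in>C. (u b * (b \<bullet> (A *v b))) *\<^sub>R b)"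
    unfolding u linear_sum[OF matrix_vector_mul_linear[of A]] matrix_vector_mult_scaleR
    by (rule sum.cong) (simp_all flip: eig scaleR_scaleR)
  show thesis
  proof (rule that[OF u Av])
    show "v \<bullet> v = (\<Sum>b\<in>C. (u b)\<^sup>2)"
      by (subst (1 2) u) (simp add: orthonormal_inner_sum[OF fin orth unit] power2_eq_square)
    show "v \<bullet> (A *v v) = (\<Sum>b\<in>C. (u b)\<^sup>2 * (b \<bullet> (A *v b)))"
      unfolding Av by (subst u)
        (simp add: orthonormal_inner_sum[OF fin orth unit] power2_eq_square mult.assoc)
  qed
qed

lemma eigenbasis_dim_span:
  assumes "eigenbasis A B" "C \<subseteq> B"
  shows "dim (span C) = card C"
proof -
  have "0 \<notin> C" using assms unfolding eigenbasis_def by force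
  moreover have "pairwise orthogonal C"
    using assms by (auto simp: eigenbasis_def intro: pairwise_subset)
  ultimately show ?thesis
    by (simp add: dim_eq_card_independent pairwise_orthogonal_independent)
qed

lemma eigenbasis_eigenspace:
  assumes B: "eigenbasis A B"
  shows "eigenspace A c = span {b\<in>B. b \<bullet> (A *v b) = c}"
proof
  show "span {b\<in>B. b \<bullet> (A *v b) = c} \<subseteq> eigenspace A c"
    using B by (intro span_minimal)
      (auto simp: eigenspace_def eigenbasis_def subspace_def matrix_vector_right_distrib
        matrix_vector_mult_scaleR scaleR_right_distrib)
  show "eigenspace A c \<subseteq> span {b\<in>B. b \<bullet> (A *v b) = c}"
  proof
    fix v assume "v \<in> eigenspace A c"
    then have ev: "A *v v = c *\<^sub>R v" by (simp add: eigenspace_def)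
    have fin: "finite B" and orth: "pairwise orthogonal B" and unit: "\<forall>b\<in>B. norm b = 1"
      using B by (auto simp: eigenbasis_def)
    obtain u where u: "v = (\<Sum>b\<in>B. u b *\<^sub>R b)"
      and Av: "A *v v = (\<Sum>b\<in>B. (u b * (b \<bullet> (A *v b))) *\<^sub>R b)"
      using eigenbasis_span_quadratic_form[OF B order_refl, of v] B
      unfolding eigenbasis_def by blast
    define w where "w b = u b * (b \<bullet> (A *v b) - c)" for b
    have "(\<Sum>b\<in>B. w b *\<^sub>R b) = A *v v - c *\<^sub>R v"
      unfolding Av by (subst u)
        (simp add: w_def algebra_simps scaleR_sum_right sum_subtractf)
    then have "(\<Sum>b\<in>B. w b * w b) = 0"
      using orthonormal_inner_sum[OF fin orth unit, of w w] ev by simp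
    then have "w b = 0" if "b \<in> B" for b
      using that fin by (simp add: sum_nonneg_eq_0_iff)
    then have "u b *\<^sub>R b \<in> span {b\<in>B. b \<bullet> (A *v b) = c}" if "b \<in> B" for b
      using that unfolding w_def by (cases "u b = 0") (auto intro: span_scale span_base span_zero)
    then show "v \<in> span {b\<in>B. b \<bullet> (A *v b) = c}"
      unfolding u by (intro span_sum)
  qed
qed

lemma sorted_concat_replicate:
  fixes xs :: "'a::linorder list"
  shows "sorted xs \<Longrightarrow> sorted (concat (map (\<lambda>c. replicate (d c) c) xs))"
  by (induction xs) (auto simp: sorted_append)

lemma count_concat_replicate:
  "distinct xs \<Longrightarrow> count (mset (concat (map (\<lambda>c. replicate (d c) c) xs))) a
     = (if a \<in> set xs then d a else 0)"
  by (induction xs) auto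

lemma sorted_sorted_eigenvalues: "sorted (sorted_eigenvalues A)"
  unfolding sorted_eigenvalues_def by (rule sorted_concat_replicate) simp

text \<open>
  Identifies the list of eigenvalues, defined through dimensions of eigenspaces, with the
  eigenvalues of the basis vectors: each eigenspace is spanned by the basis vectors in it.
\<close>

lemma mset_sorted_eigenvalues:
  assumes B: "eigenbasis A B"
  shows "mset (sorted_eigenvalues A) = image_mset (\<lambda>b. b \<bullet> (A *v b)) (mset_set B)"
proof (rule multiset_eqI)
  fix c
  have fin: "finite B" using B by (simp add: eigenbasis_def)
  let ?E = "{c. \<exists>v. v \<noteq> 0 \<and> A *v v = c *\<^sub>R v}"
  have dimc: "dim (eigenspace A a) = card {b\<in>B. b \<bullet> (A *v b) = a}" for a
    using eigenbasis_dim_span[OF B] eigenbasis_eigenspace[OF B] by (metis (no_types, lifting) mem_Collect_eq subsetI)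
  have E: "a \<in> ?E \<longleftrightarrow> dim (eigenspace A a) \<noteq> 0" for a
    by (auto simp: eigenspace_def)
  have "?E \<subseteq> (\<lambda>b. b \<bullet> (A *v b)) ` B"
  proof
    fix a assume "a \<in> ?E"
    then have "dim (eigenspace A a) \<noteq> 0" by (rule E[THEN iffD1])
    then have "{b\<in>B. b \<bullet> (A *v b) = a} \<noteq> {}" unfolding dimc by (metis card.empty)
    then show "a \<in> (\<lambda>b. b \<bullet> (A *v b)) ` B" by blast
  qed
  then have finE: "finite ?E" using fin finite_surj by blast
  have "count (mset (sorted_eigenvalues A)) c = dim (eigenspace A c)"
    unfolding sorted_eigenvalues_def using E[of c] finE
    by (subst count_concat_replicate) auto
  also have "\<dots> = card {b\<in>B. c = b \<bullet> (A *v b)}" unfolding dimc by (simp add: eq_commute)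
  also have "\<dots> = count (image_mset (\<lambda>b. b \<bullet> (A *v b)) (mset_set B)) c"
    using fin by (simp add: count_image_mset' sum.If_cases flip: card_eq_sum)
  finally show "count (mset (sorted_eigenvalues A)) c = \<dots>" .
qed

lemma length_sorted_eigenvalues:
  fixes A :: "real ^ 'n ^ 'n"
  assumes "transpose A = A"
  shows "length (sorted_eigenvalues A) = CARD('n)"
proof -
  obtain B where B: "eigenbasis A B" using symmetric_matrix_eigenbasis[OF assms] .
  have "length (sorted_eigenvalues A) = card B"
    using mset_sorted_eigenvalues[OF B] by (metis size_image_mset size_mset size_mset_set)
  also have "\<dots> = CARD('n)"
    using eigenbasis_dim_span[OF B order_refl] B unfolding eigenbasis_def
    by (metis DIM_cart DIM_real dim_UNIV mult.right_neutral)
  finally show ?thesis .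
qed

text \<open>
  The eigenvectors with eigenvalue below \<open>c\<close> span a subspace on which the quadratic form is strictly
  below \<open>c\<close>. If it is at least \<open>c\<close> on \<open>W\<close>, the two subspaces meet only in zero and their dimensions add
  up to at most that of the whole space. The factor \<open>s\<close>, taken to be \<open>1\<close> or \<open>-1\<close> later, gives this and the
  version with all inequalities reversed in one proof.
\<close>

lemma eigenvalue_count_plus_dim_le:
  fixes A :: "real ^ 'n ^ 'n"
  assumes sym: "transpose A = A" and W: "subspace W"
    and form: "\<And>w. w \<in> W \<Longrightarrow> s * (c * (w \<bullet> w)) \<le> s * (w \<bullet> (A *v w))"
  shows "length (filter (\<lambda>\<mu>. s * \<mu> < s * c) (sorted_eigenvalues A)) + dim W \<le> CARD('n)"
proof -
  obtain B where B: "eigenbasis A B" using symmetric_matrix_eigenbasis[OF sym] .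
  then have fin: "finite B" by (simp add: eigenbasis_def)
  define C where "C = {b\<in>B. s * (b \<bullet> (A *v b)) < s * c}"
  have CB: "C \<subseteq> B" and finC: "finite C" using fin by (auto simp: C_def)
  have "length (filter (\<lambda>\<mu>. s * \<mu> < s * c) (sorted_eigenvalues A))
      = size (filter_mset (\<lambda>\<mu>. s * \<mu> < s * c) (mset (sorted_eigenvalues A)))"
    by (metis mset_filter size_mset)
  also have "\<dots> = card C"
    unfolding mset_sorted_eigenvalues[OF B] filter_mset_image_mset
    using fin by (simp add: filter_mset_mset_set C_def)
  also have "\<dots> = dim (span C)" using eigenbasis_dim_span[OF B CB] by simp
  finally have count: "length (filter (\<lambda>\<mu>. s * \<mu> < s * c) (sorted_eigenvalues A)) = dim (span C)" .
  have zero: "span C \<inter> W \<subseteq> {0}"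
  proof
    fix v assume "v \<in> span C \<inter> W"
    then obtain u where u: "v = (\<Sum>b\<in>C. u b *\<^sub>R b)"
      "v \<bullet> v = (\<Sum>b\<in>C. (u b)\<^sup>2)" "v \<bullet> (A *v v) = (\<Sum>b\<in>C. (u b)\<^sup>2 * (b \<bullet> (A *v b)))"
      and "v \<in> W"
      using eigenbasis_span_quadratic_form[OF B CB, of v] by blast
    have "(\<Sum>b\<in>C. (u b)\<^sup>2 * (s * c - s * (b \<bullet> (A *v b)))) = s * (c * (v \<bullet> v)) - s * (v \<bullet> (A *v v))"
      unfolding u(2,3) by (simp add: sum_distrib_left sum_subtractf algebra_simps)
    also have "\<dots> \<le> 0" using form[OF \<open>v \<in> W\<close>] by simp
    finally have le: "(\<Sum>b\<in>C. (u b)\<^sup>2 * (s * c - s * (b \<bullet> (A *v b)))) \<le> 0" .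
    have nonneg: "(u b)\<^sup>2 * (s * c - s * (b \<bullet> (A *v b))) \<ge> 0" if "b \<in> C" for b
      using that by (simp add: C_def)
    have "(\<Sum>b\<in>C. (u b)\<^sup>2 * (s * c - s * (b \<bullet> (A *v b)))) = 0"
      using le by (rule antisym) (rule sum_nonneg, rule nonneg)
    then have "(u b)\<^sup>2 * (s * c - s * (b \<bullet> (A *v b))) = 0" if "b \<in> C" for b
      using that sum_nonneg_eq_0_iff[OF finC, of "\<lambda>b. (u b)\<^sup>2 * (s * c - s * (b \<bullet> (A *v b)))"] nonneg
      by blast
    then have "u b = 0" if "b \<in> C" for b using that by (force simp: C_def)
    then show "v \<in> {0}" unfolding u(1) by simp
  qed
  have "dim (span C) + dim W = dim {x + y |x y. x \<in> span C \<and> y \<in> W} + dim (span C \<inter> W)"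
    using dim_sums_Int[OF subspace_span W, of C] by simp
  also have "dim (span C \<inter> W) = 0" using zero by simp
  finally show ?thesis
    unfolding count using dim_subset_UNIV[of "{x + y |x y. x \<in> span C \<and> y \<in> W}"] by simp
qed

text \<open>
  One half of the Courant--Fischer principle: an eigenvalue below \<open>c\<close> at position \<open>i\<close> would mean \<open>i\<close>
  eigenvalues below \<open>c\<close>, too many for the dimension of \<open>W\<close>.
\<close>

lemma ord_eigenvalue_ge:
  fixes A :: "real ^ 'n ^ 'n"
  assumes sym: "transpose A = A" and W: "subspace W"
    and i: "i \<in> {1..CARD('n)}" and d: "CARD('n) < dim W + i"
    and form: "\<And>w. w \<in> W \<Longrightarrow> c * (w \<bullet> w) \<le> w \<bullet> (A *v w)"
  shows "c \<le> ord_eigenvalue i A"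
proof (rule ccontr)
  assume "\<not> c \<le> ord_eigenvalue i A"
  then have lt: "sorted_eigenvalues A ! (i - 1) < c" by (simp add: ord_eigenvalue_def)
  have len: "length (sorted_eigenvalues A) = CARD('n)" by (rule length_sorted_eigenvalues[OF sym])
  have "{..<i} \<subseteq> {j. j < length (sorted_eigenvalues A) \<and> sorted_eigenvalues A ! j < c}"
  proof
    fix j assume "j \<in> {..<i}"
    then have "j < length (sorted_eigenvalues A)" "sorted_eigenvalues A ! j \<le> sorted_eigenvalues A ! (i - 1)"
      using i len by (auto intro!: sorted_nth_mono[OF sorted_sorted_eigenvalues])
    with lt show "j \<in> {j. j < length (sorted_eigenvalues A) \<and> sorted_eigenvalues A ! j < c}" by simp
  qed
  from card_mono[OF _ this] have "i \<le> length (filter (\<lambda>\<mu>. \<mu> < c) (sorted_eigenvalues A))"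
    by (simp add: length_filter_conv_card)
  moreover have "length (filter (\<lambda>\<mu>. \<mu> < c) (sorted_eigenvalues A)) + dim W \<le> CARD('n)"
    using eigenvalue_count_plus_dim_le[OF sym W, of 1 c] form by simp
  ultimately show False using d by simp
qed

text \<open>
  The other half, counting the eigenvalues from position \<open>i\<close> to the end of the list.
\<close>

lemma ord_eigenvalue_le:
  fixes A :: "real ^ 'n ^ 'n"
  assumes sym: "transpose A = A" and W: "subspace W"
    and i: "i \<in> {1..CARD('n)}" and d: "i \<le> dim W"
    and form: "\<And>w. w \<in> W \<Longrightarrow> w \<bullet> (A *v w) \<le> c * (w \<bullet> w)"
  shows "ord_eigenvalue i A \<le> c"
proof (rule ccontr)
  assume "\<not> ord_eigenvalue i A \<le> c"
  then have gt: "c < sorted_eigenvalues A ! (i - 1)" by (simp add: ord_eigenvalue_def)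
  have len: "length (sorted_eigenvalues A) = CARD('n)" by (rule length_sorted_eigenvalues[OF sym])
  have "{i - 1..<CARD('n)} \<subseteq> {j. j < length (sorted_eigenvalues A) \<and> c < sorted_eigenvalues A ! j}"
  proof
    fix j assume "j \<in> {i - 1..<CARD('n)}"
    then have "j < length (sorted_eigenvalues A)" "sorted_eigenvalues A ! (i - 1) \<le> sorted_eigenvalues A ! j"
      using len by (auto intro!: sorted_nth_mono[OF sorted_sorted_eigenvalues])
    with gt show "j \<in> {j. j < length (sorted_eigenvalues A) \<and> c < sorted_eigenvalues A ! j}" by simp
  qed
  from card_mono[OF _ this] have "CARD('n) - (i - 1) \<le> length (filter (\<lambda>\<mu>. c < \<mu>) (sorted_eigenvalues A))"
    by (simp add: length_filter_conv_card)
  moreover have "length (filter (\<lambda>\<mu>. c < \<mu>) (sorted_eigenvalues A)) + dim W \<le> CARD('n)"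
    using eigenvalue_count_plus_dim_le[OF sym W, of "- 1" c] form by simp
  ultimately show False using d i by simp
qed

section \<open>Second-order calculus of C2 functions\<close>

lemma gradient_has_derivative:
  assumes "\<phi> differentiable (at x)"
  shows "(\<phi> has_derivative (\<lambda>h. gradient \<phi> x \<bullet> h)) (at x)"
proof -
  have D: "(\<phi> has_derivative frechet_derivative \<phi> (at x)) (at x)"
    using assms frechet_derivative_works by blast
  then have lin: "linear (frechet_derivative \<phi> (at x))" by (rule has_derivative_linear)
  have "frechet_derivative \<phi> (at x) h = gradient \<phi> x \<bullet> h" for h
  proof -
    have "frechet_derivative \<phi> (at x) h
        = frechet_derivative \<phi> (at x) (\<Sum>j\<in>UNIV. h $ j *\<^sub>R axis j 1)"
      by (simp add: basis_expansion flip: scalar_mult_eq_scaleR)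
    also have "\<dots> = (\<Sum>j\<in>UNIV. h $ j * frechet_derivative \<phi> (at x) (axis j 1))"
      by (simp add: linear_sum[OF lin] linear_cmul[OF lin])
    finally show ?thesis by (simp add: gradient_def inner_vec_def mult.commute)
  qed
  then show ?thesis using D by (metis (no_types, lifting) ext)
qed

lemma gradient_eqI:
  assumes "(\<phi> has_derivative (\<lambda>h. g \<bullet> h)) (at x)"
  shows "gradient \<phi> x = g"
  using frechet_derivative_at[OF assms, symmetric]
  by (simp add: gradient_def vec_eq_iff inner_axis)

lemma hessian_has_derivative:
  assumes "gradient \<phi> differentiable (at x)"
  shows "(gradient \<phi> has_derivative (\<lambda>h. hessian \<phi> x *v h)) (at x)"
  using assms jacobian_works unfolding hessian_def by blast

lemma hessian_eqI:
  assumes "(gradient \<phi> has_derivative (\<lambda>h. H *v h)) (at x)"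
  shows "hessian \<phi> x = H"
  using frechet_derivative_at[OF assms, symmetric]
  by (simp add: hessian_def jacobian_def matrix_of_matrix_vector_mul)

lemma C2_on_differentiable:
  assumes "C2_on S \<phi>" "x \<in> S"
  shows "\<phi> differentiable (at x)" "gradient \<phi> differentiable (at x)"
  using assms by (auto simp: C2_on_def)

lemma C2_on_curve_derivative:
  assumes C2: "C2_on S \<phi>" and "\<gamma> s \<in> S" and \<gamma>: "(\<gamma> has_vector_derivative \<gamma>') (at s)"
  shows "((\<lambda>s. \<phi> (\<gamma> s)) has_real_derivative gradient \<phi> (\<gamma> s) \<bullet> \<gamma>') (at s)"
  using has_derivative_compose[OF \<gamma>[unfolded has_vector_derivative_def]
      gradient_has_derivative[OF C2_on_differentiable(1)[OF C2 \<open>\<gamma> s \<in> S\<close>]]]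
  by (simp add: has_field_derivative_def mult.commute[of _ "gradient \<phi> (\<gamma> s) \<bullet> \<gamma>'"])

lemma C2_on_curve_gradient_derivative:
  assumes C2: "C2_on S \<phi>" and "\<gamma> s \<in> S" and \<gamma>: "(\<gamma> has_vector_derivative \<gamma>') (at s)"
    and \<eta>: "(\<eta> has_vector_derivative \<eta>') (at s)"
  shows "((\<lambda>s. gradient \<phi> (\<gamma> s) \<bullet> \<eta> s) has_real_derivative
           \<eta> s \<bullet> (hessian \<phi> (\<gamma> s) *v \<gamma>') + gradient \<phi> (\<gamma> s) \<bullet> \<eta>') (at s)"
proof -
  have "((\<lambda>s. gradient \<phi> (\<gamma> s)) has_derivative (\<lambda>h. hessian \<phi> (\<gamma> s) *v (h *\<^sub>R \<gamma>'))) (at s)"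
    using has_derivative_compose[OF \<gamma>[unfolded has_vector_derivative_def]
        hessian_has_derivative[OF C2_on_differentiable(2)[OF C2 \<open>\<gamma> s \<in> S\<close>]]] .
  from has_derivative_inner[OF this \<eta>[unfolded has_vector_derivative_def]]
  show ?thesis
    unfolding has_field_derivative_def
    by (rule has_derivative_eq_rhs)
      (simp add: fun_eq_iff matrix_vector_mult_scaleR inner_commute algebra_simps)
qed

text \<open>
  Restricting a test function on the punctured ball to a curve produces a test function of one
  variable. The second derivative has a Hessian term and a term from the acceleration of the curve.
\<close>

lemma C2_on_compose_curve:
  assumes C2: "C2_on S \<phi>" and T: "open T" "\<gamma> ` T \<subseteq> S"
    and \<gamma>: "\<And>s. s \<in> T \<Longrightarrow> (\<gamma> has_vector_derivative \<gamma>' s) (at s)"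
    and \<gamma>': "\<And>s. s \<in> T \<Longrightarrow> (\<gamma>' has_vector_derivative \<gamma>'' s) (at s)"
    and cont: "continuous_on T \<gamma>''"
  shows C2_on_curve_deriv: "\<And>s. s \<in> T \<Longrightarrow> deriv (\<lambda>s. \<phi> (\<gamma> s)) s = gradient \<phi> (\<gamma> s) \<bullet> \<gamma>' s"
    and C2_on_curve_deriv2: "\<And>s. s \<in> T \<Longrightarrow> deriv (deriv (\<lambda>s. \<phi> (\<gamma> s))) s
      = \<gamma>' s \<bullet> (hessian \<phi> (\<gamma> s) *v \<gamma>' s) + gradient \<phi> (\<gamma> s) \<bullet> \<gamma>'' s"
    and C2_real_on_curve: "C2_real_on T (\<lambda>s. \<phi> (\<gamma> s))"
proof -
  have S: "\<gamma> s \<in> S" if "s \<in> T" for s using that T by blast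
  note d1 = C2_on_curve_derivative[OF C2 S \<gamma>]
  show deriv1: "deriv (\<lambda>s. \<phi> (\<gamma> s)) s = gradient \<phi> (\<gamma> s) \<bullet> \<gamma>' s" if "s \<in> T" for s
    by (rule DERIV_imp_deriv[OF d1[OF that that]])
  have d2: "(deriv (\<lambda>s. \<phi> (\<gamma> s)) has_real_derivative
      \<gamma>' s \<bullet> (hessian \<phi> (\<gamma> s) *v \<gamma>' s) + gradient \<phi> (\<gamma> s) \<bullet> \<gamma>'' s) (at s)" if "s \<in> T" for s
    by (rule has_field_derivative_transform_within_open
          [OF C2_on_curve_gradient_derivative[OF C2 S[OF that] \<gamma>[OF that] \<gamma>'[OF that]] T(1) that])
      (simp add: deriv1)
  show deriv2: "deriv (deriv (\<lambda>s. \<phi> (\<gamma> s))) s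
      = \<gamma>' s \<bullet> (hessian \<phi> (\<gamma> s) *v \<gamma>' s) + gradient \<phi> (\<gamma> s) \<bullet> \<gamma>'' s" if "s \<in> T" for s
    by (rule DERIV_imp_deriv[OF d2[OF that]])
  have c\<gamma>: "continuous_on T \<gamma>" and c\<gamma>': "continuous_on T \<gamma>'"
    using \<gamma> \<gamma>' by (meson continuous_at_imp_continuous_on has_vector_derivative_continuous)+
  have "continuous_on S (gradient \<phi>)" "continuous_on S (hessian \<phi>)"
    using C2 by (auto simp: C2_on_def intro!: continuous_at_imp_continuous_on differentiable_imp_continuous_within)
  then have "continuous_on T (\<lambda>s. gradient \<phi> (\<gamma> s))" "continuous_on T (\<lambda>s. hessian \<phi> (\<gamma> s))"
    using continuous_on_compose2[OF _ c\<gamma> T(2)] by blast+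
  then have "continuous_on T
      (\<lambda>s. \<gamma>' s \<bullet> (hessian \<phi> (\<gamma> s) *v \<gamma>' s) + gradient \<phi> (\<gamma> s) \<bullet> \<gamma>'' s)"
    unfolding matrix_vector_mult_def using c\<gamma>' cont
    by (intro continuous_intros) 
  then have "continuous_on T (deriv (deriv (\<lambda>s. \<phi> (\<gamma> s))))"
    using deriv2 by (simp cong: continuous_on_cong)
  moreover have "(\<lambda>s. \<phi> (\<gamma> s)) differentiable (at s)" "deriv (\<lambda>s. \<phi> (\<gamma> s)) differentiable (at s)" if "s \<in> T" for s
    using d1[OF that that] d2[OF that] real_differentiable_def by blast+
  ultimately show "C2_real_on T (\<lambda>s. \<phi> (\<gamma> s))" by (simp add: C2_real_on_def)
qed

text \<open>
  Apply the mean value theorem first in direction \<open>u\<close> to \<open>\<phi> (\<cdot> + h v) - \<phi>\<close>, then in direction \<open>v\<close> to the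
  resulting difference of directional derivatives.
\<close>

lemma second_difference_mean_value:
  assumes C2: "C2_on S \<phi>" and r: "ball x r \<subseteq> S" and h: "h > 0" "h * (norm u + norm v) < r"
  obtains y where "dist x y \<le> h * (norm u + norm v)"
    "\<phi> (x + h *\<^sub>R u + h *\<^sub>R v) - \<phi> (x + h *\<^sub>R u) - \<phi> (x + h *\<^sub>R v) + \<phi> x
      = h\<^sup>2 * (u \<bullet> (hessian \<phi> y *v v))"
proof -
  have dist: "dist x (x + s *\<^sub>R u + t *\<^sub>R v) \<le> h * (norm u + norm v)"
    if "0 \<le> s" "s \<le> h" "0 \<le> t" "t \<le> h" for s t
  proof -
    have "dist x (x + s *\<^sub>R u + t *\<^sub>R v) \<le> s * norm u + t * norm v"
      using norm_triangle_ineq[of "s *\<^sub>R u" "t *\<^sub>R v"] that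
      by (metis abs_of_nonneg add.assoc add_diff_cancel_left' dist_commute dist_norm norm_scaleR)
    also have "\<dots> \<le> h * norm u + h * norm v"
      using that by (intro add_mono mult_right_mono) auto
    finally show ?thesis by (simp add: distrib_left)
  qed
  then have inS: "x + s *\<^sub>R u + t *\<^sub>R v \<in> S" if "0 \<le> s" "s \<le> h" "0 \<le> t" "t \<le> h" for s t
    using that h r by (meson le_less_trans mem_ball subsetD)
  have du: "((\<lambda>s. \<phi> (x + s *\<^sub>R u + t *\<^sub>R v)) has_real_derivative
      gradient \<phi> (x + s *\<^sub>R u + t *\<^sub>R v) \<bullet> u) (at s)" if "0 \<le> s" "s \<le> h" "0 \<le> t" "t \<le> h" for s t
    by (rule C2_on_curve_derivative[where \<gamma> = "\<lambda>s. x + s *\<^sub>R u + t *\<^sub>R v", OF C2 inS[OF that]])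
      (auto intro!: derivative_eq_intros)
  have "\<exists>\<xi>>0. \<xi> < h \<and> (\<phi> (x + h *\<^sub>R u + h *\<^sub>R v) - \<phi> (x + h *\<^sub>R u + 0 *\<^sub>R v))
      - (\<phi> (x + 0 *\<^sub>R u + h *\<^sub>R v) - \<phi> (x + 0 *\<^sub>R u + 0 *\<^sub>R v))
      = (h - 0) * (gradient \<phi> (x + \<xi> *\<^sub>R u + h *\<^sub>R v) \<bullet> u - gradient \<phi> (x + \<xi> *\<^sub>R u + 0 *\<^sub>R v) \<bullet> u)"
    by (rule MVT2[OF h(1)]) (use h in \<open>auto intro!: DERIV_diff du[where t = 0, simplified] du\<close>)
  then obtain \<xi> where \<xi>: "0 < \<xi>" "\<xi> < h"
    and 1: "\<phi> (x + h *\<^sub>R u + h *\<^sub>R v) - \<phi> (x + h *\<^sub>R u) - \<phi> (x + h *\<^sub>R v) + \<phi> x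
      = h * (gradient \<phi> (x + \<xi> *\<^sub>R u + h *\<^sub>R v) \<bullet> u - gradient \<phi> (x + \<xi> *\<^sub>R u + 0 *\<^sub>R v) \<bullet> u)"
    by auto
  have dv: "((\<lambda>t. gradient \<phi> (x + \<xi> *\<^sub>R u + t *\<^sub>R v) \<bullet> u) has_real_derivative
      u \<bullet> (hessian \<phi> (x + \<xi> *\<^sub>R u + t *\<^sub>R v) *v v) + gradient \<phi> (x + \<xi> *\<^sub>R u + t *\<^sub>R v) \<bullet> 0) (at t)"
    if "0 \<le> t" "t \<le> h" for t
    using \<xi> that
    by (intro C2_on_curve_gradient_derivative
          [where \<gamma> = "\<lambda>t. x + \<xi> *\<^sub>R u + t *\<^sub>R v", OF C2 inS])
      (auto intro!: derivative_eq_intros)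
  obtain \<eta> where \<eta>: "0 < \<eta>" "\<eta> < h"
    and 2: "gradient \<phi> (x + \<xi> *\<^sub>R u + h *\<^sub>R v) \<bullet> u - gradient \<phi> (x + \<xi> *\<^sub>R u + 0 *\<^sub>R v) \<bullet> u
      = (h - 0) * (u \<bullet> (hessian \<phi> (x + \<xi> *\<^sub>R u + \<eta> *\<^sub>R v) *v v) + gradient \<phi> (x + \<xi> *\<^sub>R u + \<eta> *\<^sub>R v) \<bullet> 0)"
    using MVT2[OF h(1) dv] by blast
  show thesis
  proof (rule that)
    show "dist x (x + \<xi> *\<^sub>R u + \<eta> *\<^sub>R v) \<le> h * (norm u + norm v)"
      using dist \<xi> \<eta> by simp
    show "\<phi> (x + h *\<^sub>R u + h *\<^sub>R v) - \<phi> (x + h *\<^sub>R u) - \<phi> (x + h *\<^sub>R v) + \<phi> x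
        = h\<^sup>2 * (u \<bullet> (hessian \<phi> (x + \<xi> *\<^sub>R u + \<eta> *\<^sub>R v) *v v))"
      unfolding 1 2 by (simp add: power2_eq_square)
  qed
qed

text \<open>
  The second difference quotient is symmetric in its two directions and, by the preceding lemma, is
  a value of the Hessian form at a nearby point. Continuity of the Hessian lets that point tend to \<open>x\<close>.
\<close>

lemma hessian_symmetric:
  fixes \<phi> :: "real ^ 'n \<Rightarrow> real"
  assumes C2: "C2_on S \<phi>" and S: "open S" "x \<in> S"
  shows "transpose (hessian \<phi> x) = hessian \<phi> x"
proof -
  have swap: "u \<bullet> (hessian \<phi> x *v v) = v \<bullet> (hessian \<phi> x *v u)" for u v
  proof (rule ccontr)
    define k where "k y = u \<bullet> (hessian \<phi> y *v v)" for y
    define l where "l y = v \<bullet> (hessian \<phi> y *v u)" for y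
    assume "u \<bullet> (hessian \<phi> x *v v) \<noteq> v \<bullet> (hessian \<phi> x *v u)"
    then have kl: "k x \<noteq> l x" by (simp add: k_def l_def)
    define \<epsilon> where "\<epsilon> = \<bar>k x - l x\<bar> / 2"
    have \<epsilon>: "\<epsilon> > 0" using kl by (simp add: \<epsilon>_def)
    have "continuous_on S (hessian \<phi>)" using C2 by (simp add: C2_on_def)
    then have "continuous_on S k" "continuous_on S l"
      unfolding k_def l_def matrix_vector_mult_def by (auto intro!: continuous_intros)
    then have "isCont k x" "isCont l x"
      using S continuous_on_eq_continuous_at by blast+
    then obtain d1 d2 where d: "d1 > 0" "d2 > 0"
      and k: "\<And>y. dist y x < d1 \<Longrightarrow> dist (k y) (k x) < \<epsilon>"
      and l: "\<And>y. dist y x < d2 \<Longrightarrow> dist (l y) (l x) < \<epsilon>"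
      using \<epsilon> unfolding continuous_at_eps_delta by metis
    obtain r where r: "r > 0" "ball x r \<subseteq> S" using S openE by blast
    define c where "c = norm u + norm v + 1"
    have c: "c > 0" by (simp add: c_def add_nonneg_pos)
    define h where "h = min r (min d1 d2) / c"
    have h: "h > 0" using r d c by (simp add: h_def)
    have "h * (norm u + norm v) < h * c" using h by (simp add: c_def)
    also have "\<dots> = min r (min d1 d2)" using c by (simp add: h_def)
    finally have small: "h * (norm u + norm v) < r" "h * (norm u + norm v) < d1"
      "h * (norm u + norm v) < d2" by auto
    obtain y where y: "dist x y \<le> h * (norm u + norm v)"
      "\<phi> (x + h *\<^sub>R u + h *\<^sub>R v) - \<phi> (x + h *\<^sub>R u) - \<phi> (x + h *\<^sub>R v) + \<phi> x = h\<^sup>2 * k y"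
      using second_difference_mean_value[OF C2 r(2) h small(1)] unfolding k_def by blast
    obtain z where z: "dist x z \<le> h * (norm u + norm v)"
      "\<phi> (x + h *\<^sub>R v + h *\<^sub>R u) - \<phi> (x + h *\<^sub>R v) - \<phi> (x + h *\<^sub>R u) + \<phi> x = h\<^sup>2 * l z"
      using second_difference_mean_value[OF C2 r(2) h, of v u] small(1)
      unfolding l_def by (metis add.commute)
    have "h\<^sup>2 * k y = h\<^sup>2 * l z"
      unfolding y(2)[symmetric] z(2)[symmetric] by (simp add: algebra_simps)
    then have "k y = l z" using h by simp
    moreover have "dist (k y) (k x) < \<epsilon>" "dist (l z) (l x) < \<epsilon>"
      using k[of y] l[of z] y(1) z(1) small by (simp_all add: dist_commute[of x])
    moreover have "\<bar>k x - l x\<bar> \<le> \<bar>k y - k x\<bar> + \<bar>k y - l x\<bar>" by arith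
    ultimately show False unfolding \<epsilon>_def dist_real_def by simp
  qed
  have entry: "axis i 1 \<bullet> (hessian \<phi> x *v axis j 1) = hessian \<phi> x $ i $ j" for i j :: 'n
    by (simp add: inner_axis' matrix_vector_mul_component inner_axis)
  show ?thesis
    using swap[of "axis _ 1" "axis _ 1"] by (simp add: entry transpose_def vec_eq_iff)
qed

text \<open>
  If the second derivative at the minimum were negative, the first derivative would be negative just
  to the right of it, and the function would decrease there.
\<close>

lemma local_min_derivative_tests:
  fixes g g' :: "real \<Rightarrow> real"
  assumes min: "\<forall>\<^sub>F t in nhds a. g a \<le> g t"
    and g: "\<And>t. (g has_real_derivative g' t) (at t)" and g': "(g' has_real_derivative c) (at a)"
  shows "g' a = 0" "0 \<le> c"
proof -
  obtain d where d: "d > 0" "\<And>t. dist t a < d \<Longrightarrow> g a \<le> g t"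
    using min unfolding eventually_nhds_metric by blast
  show zero: "g' a = 0"
    by (rule DERIV_local_min[OF g d(1)]) (use d(2) in \<open>auto simp: dist_real_def abs_minus_commute\<close>)
  show "0 \<le> c"
  proof (rule ccontr)
    assume "\<not> 0 \<le> c"
    then obtain \<delta> where \<delta>: "\<delta> > 0" "\<And>h. 0 < h \<Longrightarrow> h < \<delta> \<Longrightarrow> g' (a + h) < 0"
      using DERIV_neg_dec_right[OF g'] zero by auto
    define t where "t = a + min d \<delta> / 2"
    have t: "a < t" "dist t a < d" "t < a + \<delta>" using d(1) \<delta>(1) by (auto simp: t_def dist_real_def)
    obtain z where z: "a < z" "z < t" "g t - g a = (t - a) * g' z"
      using MVT2[OF t(1) g] by blast
    have "g' z < 0" using \<delta>(2)[of "z - a"] z t by simp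
    then have "g t < g a" using z t by (smt (verit) mult_pos_neg)
    then show False using d(2)[OF t(2)] by simp
  qed
qed

section \<open>Radial test functions\<close>

lemma punctured_ball_iff: "x \<in> punctured_ball R \<longleftrightarrow> 0 < norm x \<and> norm x < R"
  by (auto simp: punctured_ball_def)

lemma open_punctured_ball: "open (punctured_ball R)"
  unfolding punctured_ball_def by (intro open_Diff) auto

text \<open>
  With \<open>\<psi> r = \<phi>' r / r\<close> the gradient of \<open>\<phi> (norm x)\<close> is \<open>\<psi> (norm x) x\<close>, and differentiating this product
  gives the Hessian as a multiple of the identity plus a rank-one matrix. In the conclusion
  \<open>(sgn x \<bullet> w)\<^sup>2\<close> and \<open>w \<bullet> w - (sgn x \<bullet> w)\<^sup>2\<close> are the squared lengths of the radial and the tangential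
  part of \<open>w\<close>.
\<close>

lemma radial_function:
  fixes x :: "real ^ 'n"
  assumes C2: "C2_real_on {0<..<R} \<phi>"
  shows radial_C2_on: "C2_on (punctured_ball R :: (real ^ 'n) set) (\<lambda>x. \<phi> (norm x))"
    and radial_gradient: "x \<in> punctured_ball R \<Longrightarrow>
      gradient (\<lambda>x. \<phi> (norm x)) x = (deriv \<phi> (norm x) / norm x) *\<^sub>R x"
    and radial_hessian: "x \<in> punctured_ball R \<Longrightarrow>
      w \<bullet> (hessian (\<lambda>x. \<phi> (norm x)) x *v w)
        = deriv \<phi> (norm x) / norm x * (w \<bullet> w - (sgn x \<bullet> w)\<^sup>2) + deriv (deriv \<phi>) (norm x) * (sgn x \<bullet> w)\<^sup>2"
proof -
  define \<psi> where "\<psi> r = deriv \<phi> r / r" for r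
  define \<psi>' where "\<psi>' r = (deriv (deriv \<phi>) r - \<psi> r) / r" for r
  define H :: "real ^ 'n \<Rightarrow> real ^ 'n ^ 'n" where
    "H x = \<psi> (norm x) *\<^sub>R mat 1 + (\<psi>' (norm x) / norm x) *\<^sub>R (\<chi> i j. x $ i * x $ j)" for x
  have outer: "(\<chi> i j. x $ i * x $ j) *v h = (x \<bullet> h) *\<^sub>R x" for x h :: "real ^ 'n"
    by (simp add: vec_eq_iff matrix_vector_mult_def inner_vec_def sum_distrib_left mult.commute mult.left_commute)
  have Hv: "H x *v h = \<psi> (norm x) *\<^sub>R h + (\<psi>' (norm x) / norm x * (x \<bullet> h)) *\<^sub>R x" for x h
    by (simp add: H_def matrix_vector_mult_add_rdistrib outer flip: scaleR_matrix_vector_assoc)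
  have \<phi>: "(\<phi> has_real_derivative deriv \<phi> r) (at r)"
    and \<phi>': "(deriv \<phi> has_real_derivative deriv (deriv \<phi>) r) (at r)" if "r \<in> {0<..<R}" for r
    using C2 that by (auto simp: C2_real_on_def DERIV_deriv_iff_real_differentiable)
  have \<psi>: "(\<psi> has_real_derivative \<psi>' r) (at r)" if "r \<in> {0<..<R}" for r
    unfolding \<psi>_def[abs_def] using that
    by (auto intro!: derivative_eq_intros \<phi>' simp: \<psi>'_def \<psi>_def field_simps)
  have d1: "((\<lambda>x. \<phi> (norm x)) has_derivative (\<lambda>h. (\<psi> (norm x) *\<^sub>R x) \<bullet> h)) (at x)"
    if "x \<in> punctured_ball R" for x :: "real ^ 'n"
  proof -
    have x: "norm x \<in> {0<..<R}" "x \<noteq> 0" using that by (auto simp: punctured_ball_iff)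
    show ?thesis
      by (rule has_derivative_eq_rhs[OF has_derivative_compose
            [OF has_derivative_norm[OF x(2)] \<phi>[OF x(1), unfolded has_field_derivative_def]]])
        (simp add: fun_eq_iff \<psi>_def sgn_div_norm inner_commute divide_inverse)
  qed
  have grad: "gradient (\<lambda>x. \<phi> (norm x)) x = \<psi> (norm x) *\<^sub>R x"
    if "x \<in> punctured_ball R" for x :: "real ^ 'n"
    by (rule gradient_eqI[OF d1[OF that]])
  have d2: "(gradient (\<lambda>x. \<phi> (norm x)) has_derivative (\<lambda>h. H x *v h)) (at x)"
    if "x \<in> punctured_ball R" for x :: "real ^ 'n"
  proof -
    have x: "norm x \<in> {0<..<R}" "x \<noteq> 0" using that by (auto simp: punctured_ball_iff)
    have "((\<lambda>x. \<psi> (norm x) *\<^sub>R x) has_derivative (\<lambda>h. H x *v h)) (at x)"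
      by (rule has_derivative_eq_rhs[OF has_derivative_scaleR[OF has_derivative_compose
            [OF has_derivative_norm[OF x(2)] \<psi>[OF x(1), unfolded has_field_derivative_def]]
            has_derivative_ident]])
        (simp add: fun_eq_iff Hv sgn_div_norm inner_commute divide_inverse mult.assoc)
    then show ?thesis
      by (rule has_derivative_transform_within_open[OF _ open_punctured_ball that])
        (simp add: grad)
  qed
  have hess: "hessian (\<lambda>x. \<phi> (norm x)) x = H x" if "x \<in> punctured_ball R" for x :: "real ^ 'n"
    by (rule hessian_eqI[OF d2[OF that]])
  show "C2_on (punctured_ball R :: (real ^ 'n) set) (\<lambda>x. \<phi> (norm x))"
    unfolding C2_on_def
  proof (intro conjI ballI)
    show "(\<lambda>x. \<phi> (norm x)) differentiable (at x)"
      "gradient (\<lambda>x. \<phi> (norm x)) differentiable (at x)"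
      if "x \<in> punctured_ball R" for x :: "real ^ 'n"
      using d1[OF that] d2[OF that] by (auto simp: differentiable_def)
    let ?P = "punctured_ball R :: (real ^ 'n) set"
    have sub: "norm ` ?P \<subseteq> {0<..<R}" by (auto simp: punctured_ball_iff)
    have \<psi>_cont: "continuous_on {0<..<R} \<psi>"
      using \<psi> by (meson DERIV_continuous_on has_field_derivative_at_within)
    have "continuous_on {0<..<R} \<psi>'"
      unfolding \<psi>'_def[abs_def] using C2 \<psi>_cont
      by (auto intro!: continuous_intros simp: C2_real_on_def)
    then have "continuous_on ?P (\<lambda>x. \<psi> (norm x))" "continuous_on ?P (\<lambda>x. \<psi>' (norm x))"
      using \<psi>_cont continuous_on_compose2[OF _ _ sub] continuous_on_norm_id by blast+
    then have "continuous_on ?P H"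
      unfolding H_def[abs_def]
      by (intro continuous_intros) (auto simp: punctured_ball_iff)
    then show "continuous_on ?P (hessian (\<lambda>x. \<phi> (norm x)))"
      using hess by (simp cong: continuous_on_cong)
  qed
  assume x: "x \<in> punctured_ball R"
  then show "gradient (\<lambda>x. \<phi> (norm x)) x = (deriv \<phi> (norm x) / norm x) *\<^sub>R x"
    by (simp add: grad \<psi>_def)
  have "x \<noteq> 0" using x by (auto simp: punctured_ball_iff)
  then have "w \<bullet> (H x *v w) = \<psi> (norm x) * (w \<bullet> w) + \<psi>' (norm x) * norm x * (sgn x \<bullet> w)\<^sup>2"
    unfolding Hv by (simp add: inner_add_right sgn_div_norm inner_commute power2_eq_square field_simps)
  also have "\<psi>' (norm x) * norm x = deriv (deriv \<phi>) (norm x) - \<psi> (norm x)"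
    using \<open>x \<noteq> 0\<close> by (simp add: \<psi>'_def)
  finally show "w \<bullet> (hessian (\<lambda>x. \<phi> (norm x)) x *v w)
        = deriv \<phi> (norm x) / norm x * (w \<bullet> w - (sgn x \<bullet> w)\<^sup>2) + deriv (deriv \<phi>) (norm x) * (sgn x \<bullet> w)\<^sup>2"
    unfolding hess[OF x] by (simp add: \<psi>_def algebra_simps)
qed

section \<open>Restricting the punctured ball equation to radial test functions\<close>

lemma local_max_at_compose:
  assumes "local_max_at F (g a)" "isCont g a"
  shows "local_max_at (\<lambda>s. F (g s)) a"
proof -
  have "filterlim g (nhds (g a)) (nhds a)"
    using assms(2) by (simp add: isCont_def tendsto_at_iff_tendsto_nhds)
  then show ?thesis
    using assms(1) unfolding local_max_at_def filterlim_iff by blast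
qed

lemma local_max_at_cong:
  assumes "\<forall>\<^sub>F s in nhds a. F s = G s" "local_max_at F a"
  shows "local_max_at G a"
  using assms eventually_nhds_x_imp_x[OF assms(1)] unfolding local_max_at_def
  by (auto elim: eventually_elim2)

lemma exists_unit_orthogonal:
  fixes e :: "'a::euclidean_space"
  assumes "2 \<le> DIM('a)"
  obtains w where "norm w = 1" "e \<bullet> w = 0"
proof -
  obtain y where "y \<noteq> 0" "orthogonal e y" using orthogonal_to_vector_exists[OF assms] by blast
  then show thesis using that[of "sgn y"] by (simp add: norm_sgn orthogonal_def sgn_div_norm)
qed

text \<open>
  The radial Hessian is compared with \<open>lambda_bar\<close> through its quadratic form, restricted to the
  radial line or a tangential line (\<open>i = 1\<close>), the tangential hyperplane (\<open>1 < i < N\<close>), or the whole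
  space (\<open>i = N\<close>).
\<close>

lemma PDE_imp_ODE:
  fixes U f :: "real \<Rightarrow> real"
  assumes N: "CARD('n::finite) \<ge> 2" and i: "i \<in> {1..CARD('n)}"
    and PDE: "visc_subsol_PDE i p f R (\<lambda>x :: real ^ 'n. U (norm x))"
  shows "visc_subsol_ODE CARD('n) i p f R U"
  unfolding visc_subsol_ODE_def
proof (intro allI impI ballI)
  fix \<phi> r
  assume C2: "C2_real_on {0<..<R} \<phi>" and r: "r \<in> {0<..<R}" and max: "local_max_at (\<lambda>s. U s - \<phi> s) r"
  let ?\<Phi> = "\<lambda>x :: real ^ 'n. \<phi> (norm x)"
  obtain e :: "real ^ 'n" where e: "norm e = 1" using vector_choose_size[of 1] by auto
  define x where "x = r *\<^sub>R e"
  have nx: "norm x = r" and sx: "sgn x = e"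
    using r e by (simp_all add: x_def sgn_div_norm)
  have x: "x \<in> punctured_ball R" using r nx by (simp add: punctured_ball_iff)
  have ee: "e \<bullet> e = 1" using e by (simp add: norm_eq_1)
  obtain w where w: "norm w = 1" "e \<bullet> w = 0" using exists_unit_orthogonal[of e] N by auto
  have ww: "w \<bullet> w = 1" using w by (simp add: norm_eq_1)
  let ?H = "hessian ?\<Phi> x" and ?d = "deriv \<phi> r" and ?dd = "deriv (deriv \<phi>) r"
  have form: "v \<bullet> (?H *v v) = ?d / r * (v \<bullet> v - (e \<bullet> v)\<^sup>2) + ?dd * (e \<bullet> v)\<^sup>2" for v
    using radial_hessian[OF C2 x, of v] by (simp add: nx sx)
  have sym: "transpose ?H = ?H"
    by (rule hessian_symmetric[OF radial_C2_on[OF C2] open_punctured_ball x])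
  have "local_max_at (\<lambda>y. U (norm y) - ?\<Phi> y) x"
    using local_max_at_compose[of "\<lambda>s. U s - \<phi> s" norm x] max nx by (simp add: continuous_norm)
  then have "- ord_eigenvalue i ?H + norm (gradient ?\<Phi> x) powr p \<le> f (norm x)"
    using PDE radial_C2_on[OF C2] x unfolding visc_subsol_PDE_def by blast
  moreover have "norm (gradient ?\<Phi> x) = \<bar>?d\<bar>"
    using r by (simp add: radial_gradient[OF C2 x] nx)
  moreover have "ord_eigenvalue i ?H \<le> lambda_bar CARD('n) i r ?dd ?d"
  proof -
    have cauchy: "(e \<bullet> v)\<^sup>2 \<le> v \<bullet> v" for v
      using Cauchy_Schwarz_ineq[of e v] ee by simp
    consider "i = 1" | "1 < i" "i < CARD('n)" | "1 < i" "i = CARD('n)" using i by fastforce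
    then show ?thesis
    proof cases
      case 1
      have line: "ord_eigenvalue i ?H \<le> c" if "v \<bullet> v = 1" "v \<bullet> (?H *v v) \<le> c" for v c
      proof (rule ord_eigenvalue_le[OF sym subspace_span[of "{v}"] i])
        have "v \<noteq> 0" using that by auto
        then show "i \<le> dim (span {v})" using 1 by (simp add: dim_span dim_singleton)
        fix u assume "u \<in> span {v}"
        then obtain k where u: "u = k *\<^sub>R v" by (auto simp: span_singleton)
        have "u \<bullet> (?H *v u) = (k * k) * (v \<bullet> (?H *v v))" "u \<bullet> u = k * k"
          using that by (simp_all add: u matrix_vector_mult_scaleR)
        then show "u \<bullet> (?H *v u) \<le> c * (u \<bullet> u)"
          using mult_left_mono[OF that(2), of "k * k"] by (simp add: mult.commute)
      qed
      have "ord_eigenvalue i ?H \<le> ?dd" "ord_eigenvalue i ?H \<le> ?d / r"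
        using line[OF ee] line[OF ww] by (simp_all add: form ee ww w)
      then show ?thesis by (simp add: lambda_bar_def 1)
    next
      case 2
      have "ord_eigenvalue i ?H \<le> ?d / r"
      proof (rule ord_eigenvalue_le[OF sym subspace_hyperplane[of e] i])
        have "e \<noteq> 0" using e by auto
        then show "i \<le> dim {v. e \<bullet> v = 0}" using 2 by (simp add: dim_hyperplane)
      qed (simp add: form)
      then show ?thesis using 2 by (simp add: lambda_bar_def)
    next
      case 3
      have "ord_eigenvalue i ?H \<le> max ?dd (?d / r)"
      proof (rule ord_eigenvalue_le[OF sym subspace_UNIV i])
        fix v :: "real ^ 'n"
        have "?d / r * (v \<bullet> v - (e \<bullet> v)\<^sup>2) + ?dd * (e \<bullet> v)\<^sup>2
            \<le> max ?dd (?d / r) * (v \<bullet> v - (e \<bullet> v)\<^sup>2) + max ?dd (?d / r) * (e \<bullet> v)\<^sup>2"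
          using cauchy[of v] by (intro add_mono mult_right_mono) auto
        then show "v \<bullet> (?H *v v) \<le> max ?dd (?d / r) * (v \<bullet> v)"
          unfolding form by (simp add: algebra_simps)
      qed (use i in simp)
      then show ?thesis using 3 by (simp add: lambda_bar_def)
    qed
  qed
  ultimately show "- lambda_bar CARD('n) i r ?dd ?d + \<bar>?d\<bar> powr p \<le> f r"
    by (simp add: nx)
qed

section \<open>Testing along great circles and swept curves\<close>

text \<open>
  For orthonormal \<open>e\<close> and \<open>w\<close> this is the unit-speed great circle from \<open>e\<close> in the direction \<open>w\<close>. Its
  velocity is again of this form, with the pair \<open>(e, w)\<close> replaced by \<open>(w, - e)\<close>, so the family is closed
  under differentiation.
\<close>

definition great_circle :: "'a::real_vector \<Rightarrow> 'a \<Rightarrow> real \<Rightarrow> 'a" where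
  "great_circle e w t = cos t *\<^sub>R e + sin t *\<^sub>R w"

lemma great_circle_0 [simp]: "great_circle e w 0 = e"
  by (simp add: great_circle_def)

lemma great_circle_has_vector_derivative:
  "(great_circle e w has_vector_derivative great_circle w (- e) t) (at t)"
  unfolding great_circle_def[abs_def]
  by (auto intro!: derivative_eq_intros simp: algebra_simps)

lemma great_circle_compose_has_vector_derivative:
  "((\<lambda>s. great_circle e w (a * (s - r))) has_vector_derivative a *\<^sub>R great_circle w (- e) (a * (s - r))) (at s)"
proof -
  have "((\<lambda>s. a * (s - r)) has_vector_derivative a) (at s)"
    by (auto intro!: derivative_eq_intros)
  from vector_diff_chain_at[OF this great_circle_has_vector_derivative] show ?thesis
    by (simp add: o_def)
qed

lemma norm_great_circle:
  assumes "norm e = 1" "norm w = 1" "e \<bullet> w = 0"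
  shows "norm (great_circle e w t) = 1"
proof -
  have "great_circle e w t \<bullet> great_circle e w t = (cos t)\<^sup>2 + (sin t)\<^sup>2"
    using assms by (simp add: great_circle_def inner_add inner_commute norm_eq_1 power2_eq_square)
  then show ?thesis by (simp add: norm_eq_1)
qed

text \<open>
  On the sphere through \<open>x\<close> the function \<open>U (norm y)\<close> is constant, hence \<open>\<Phi>\<close> has a local minimum along
  every great circle through \<open>x\<close>. The second derivative along the circle of radius \<open>r\<close> is
  \<open>r\<^sup>2 (w \<bullet> H w) - r (g \<bullet> e)\<close>, since the acceleration points to the centre.
\<close>

lemma spherical_test:
  fixes U :: "real \<Rightarrow> real" and x :: "real ^ 'n"
  assumes C2: "C2_on (punctured_ball R) \<Phi>" and x: "x \<in> punctured_ball R"
    and max: "local_max_at (\<lambda>y. U (norm y) - \<Phi> y) x"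
    and w: "norm w = 1" "sgn x \<bullet> w = 0"
  shows "gradient \<Phi> x \<bullet> w = 0" "gradient \<Phi> x \<bullet> sgn x / norm x \<le> w \<bullet> (hessian \<Phi> x *v w)"
proof -
  define r where "r = norm x"
  define e where "e = sgn x"
  have r: "0 < r" "r < R" using x by (auto simp: r_def punctured_ball_iff)
  then have e: "norm e = 1" by (auto simp: e_def r_def norm_sgn)
  have xe: "x = r *\<^sub>R e" using r by (simp add: r_def e_def sgn_div_norm)
  have we: "e \<bullet> w = 0" "w \<bullet> e = 0" using w by (simp_all add: e_def inner_commute)
  let ?\<gamma> = "\<lambda>t. r *\<^sub>R great_circle e w t"
  have norm\<gamma>: "norm (?\<gamma> t) = r" for t using r e w we by (simp add: norm_great_circle)
  have in\<gamma>: "?\<gamma> t \<in> punctured_ball R" for t unfolding punctured_ball_iff norm\<gamma> using r by simp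
  have \<gamma>: "(?\<gamma> has_vector_derivative r *\<^sub>R great_circle w (- e) t) (at t)" for t
    by (auto intro!: derivative_eq_intros great_circle_has_vector_derivative)
  have \<gamma>': "((\<lambda>t. r *\<^sub>R great_circle w (- e) t) has_vector_derivative r *\<^sub>R great_circle (- e) (- w) t) (at t)" for t
    by (auto intro!: derivative_eq_intros great_circle_has_vector_derivative)
  have "isCont ?\<gamma> 0" using \<gamma> has_vector_derivative_continuous by blast
  then have "local_max_at (\<lambda>t. U (norm (?\<gamma> t)) - \<Phi> (?\<gamma> t)) 0"
    using local_max_at_compose[of "\<lambda>y. U (norm y) - \<Phi> y" ?\<gamma> 0] max xe by simp
  then have min: "\<forall>\<^sub>F t in nhds 0. \<Phi> (?\<gamma> 0) \<le> \<Phi> (?\<gamma> t)"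
    unfolding local_max_at_def norm\<gamma> by simp
  note tests = local_min_derivative_tests[OF min C2_on_curve_derivative[OF C2 in\<gamma> \<gamma>]
      C2_on_curve_gradient_derivative[OF C2 in\<gamma> \<gamma> \<gamma>']]
  show "gradient \<Phi> x \<bullet> w = 0" using tests(1) r xe by simp
  have "0 \<le> r * (r * (w \<bullet> (hessian \<Phi> x *v w)) - gradient \<Phi> x \<bullet> e)"
    using tests(2) xe by (simp add: matrix_vector_mult_scaleR algebra_simps)
  then show "gradient \<Phi> x \<bullet> sgn x / norm x \<le> w \<bullet> (hessian \<Phi> x *v w)"
    using r unfolding e_def[symmetric] r_def[symmetric] by (simp add: zero_le_mult_iff field_simps)
qed

text \<open>
  The curve leaves along the ray while turning towards \<open>w\<close>. Being parametrised by its distance to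
  the origin, it turns \<open>\<Phi>\<close> into a test function for \<open>U\<close> itself; the free slope \<open>b\<close> makes it
  possible to reach every direction transversal to the sphere.
\<close>

lemma swept_curve_test:
  fixes U f :: "real \<Rightarrow> real" and x w :: "real ^ 'n"
  assumes ODE: "visc_subsol_ODE N i p f R U"
    and C2: "C2_on (punctured_ball R) \<Phi>" and x: "x \<in> punctured_ball R"
    and max: "local_max_at (\<lambda>y. U (norm y) - \<Phi> y) x"
    and w: "norm w = 1" "sgn x \<bullet> w = 0"
  shows "\<bar>gradient \<Phi> x \<bullet> sgn x\<bar> powr p - f (norm x) \<le> lambda_bar N i (norm x)
    ((sgn x + b *\<^sub>R w) \<bullet> (hessian \<Phi> x *v (sgn x + b *\<^sub>R w)) - b\<^sup>2 * (gradient \<Phi> x \<bullet> sgn x / norm x))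
    (gradient \<Phi> x \<bullet> sgn x)"
proof -
  define r where "r = norm x"
  define e where "e = sgn x"
  (* Angular speed for which the curve passes x with velocity e + b w. *)
  define a where "a = b / r"
  have r: "0 < r" "r < R" using x by (auto simp: r_def punctured_ball_iff)
  then have e: "norm e = 1" by (auto simp: e_def r_def norm_sgn)
  have xe: "x = r *\<^sub>R e" using r by (simp add: r_def e_def sgn_div_norm)
  have we: "e \<bullet> w = 0" "w \<bullet> e = 0" using w by (simp_all add: e_def inner_commute)
  let ?\<sigma> = "\<lambda>s. great_circle e w (a * (s - r))" and ?\<tau> = "\<lambda>s. great_circle w (- e) (a * (s - r))"
  let ?\<gamma> = "\<lambda>s. s *\<^sub>R ?\<sigma> s"
  let ?\<gamma>' = "\<lambda>s. ?\<sigma> s + (s * a) *\<^sub>R ?\<tau> s"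
  let ?\<gamma>'' = "\<lambda>s. a *\<^sub>R ?\<tau> s + ((s * a) *\<^sub>R (a *\<^sub>R great_circle (- e) (- w) (a * (s - r))) + a *\<^sub>R ?\<tau> s)"
  have norm\<gamma>: "norm (?\<gamma> s) = \<bar>s\<bar>" for s using e w we by (simp add: norm_great_circle)
  have img: "?\<gamma> ` {0<..<R} \<subseteq> punctured_ball R"
    using norm\<gamma> by (auto simp: punctured_ball_iff simp del: norm_scaleR)
  have \<gamma>: "(?\<gamma> has_vector_derivative ?\<gamma>' s) (at s)" for s
    by (auto intro!: derivative_eq_intros great_circle_compose_has_vector_derivative)
  have \<gamma>': "(?\<gamma>' has_vector_derivative ?\<gamma>'' s) (at s)" for s
    by (rule has_vector_derivative_eq_rhs, (rule derivative_intros great_circle_compose_has_vector_derivative)+)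
      (auto intro!: derivative_eq_intros)
  have cont: "continuous_on {0<..<R} ?\<gamma>''"
    unfolding great_circle_def by (intro continuous_intros)
  note chain = C2_on_compose_curve[OF C2 open_greaterThanLessThan img \<gamma> \<gamma>' cont]
  define \<phi> where "\<phi> = (\<lambda>s. \<Phi> (?\<gamma> s))"
  have "isCont ?\<gamma> r" using \<gamma> has_vector_derivative_continuous by blast
  then have "local_max_at (\<lambda>s. U (norm (?\<gamma> s)) - \<phi> s) r"
    using local_max_at_compose[of "\<lambda>y. U (norm y) - \<Phi> y" ?\<gamma> r] max xe by (simp add: \<phi>_def)
  moreover have "\<forall>\<^sub>F s in nhds r. U (norm (?\<gamma> s)) - \<phi> s = U s - \<phi> s"
    using eventually_nhds_in_open[OF open_greaterThan, of r 0] r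
    unfolding norm\<gamma> by (auto elim: eventually_mono)
  ultimately have "local_max_at (\<lambda>s. U s - \<phi> s) r" by (rule local_max_at_cong[rotated])
  then have ineq: "- lambda_bar N i r (deriv (deriv \<phi>) r) (deriv \<phi> r) + \<bar>deriv \<phi> r\<bar> powr p \<le> f r"
    using ODE chain(3) r unfolding visc_subsol_ODE_def \<phi>_def by auto
  have gw: "gradient \<Phi> x \<bullet> w = 0" by (rule spherical_test(1)[OF C2 x max w])
  have ra: "r * a = b" using r by (simp add: a_def)
  have "deriv \<phi> r = gradient \<Phi> x \<bullet> e"
    using chain(1)[of r] r gw by (simp add: \<phi>_def xe[symmetric] inner_add_right)
  moreover have "deriv (deriv \<phi>) r
      = (e + b *\<^sub>R w) \<bullet> (hessian \<Phi> x *v (e + b *\<^sub>R w)) - b\<^sup>2 * (gradient \<Phi> x \<bullet> e / r)"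
  proof -
    have "deriv (deriv \<phi>) r = (e + b *\<^sub>R w) \<bullet> (hessian \<Phi> x *v (e + b *\<^sub>R w))
        + gradient \<Phi> x \<bullet> (a *\<^sub>R w + ((r * a) *\<^sub>R (a *\<^sub>R (- e)) + a *\<^sub>R w))"
      using chain(2)[of r] r by (simp add: \<phi>_def xe[symmetric] ra)
    also have "gradient \<Phi> x \<bullet> (a *\<^sub>R w + ((r * a) *\<^sub>R (a *\<^sub>R (- e)) + a *\<^sub>R w))
        = - (b\<^sup>2 * (gradient \<Phi> x \<bullet> e / r))"
      unfolding inner_add_right inner_scaleR_right inner_minus_right gw ra
      by (simp add: a_def power2_eq_square)
    finally show ?thesis by simp
  qed
  ultimately show ?thesis using ineq unfolding r_def[symmetric] e_def[symmetric] by simp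
qed

lemma radial_decomposition:
  fixes e v :: "'a::euclidean_space"
  assumes "norm e = 1" "2 \<le> DIM('a)"
  obtains \<alpha> \<beta> w where "v = \<alpha> *\<^sub>R e + \<beta> *\<^sub>R w" "norm w = 1" "e \<bullet> w = 0"
proof -
  define y where "y = v - (e \<bullet> v) *\<^sub>R e"
  have ey: "e \<bullet> y = 0" using assms(1) by (simp add: y_def inner_diff_right norm_eq_1)
  have v: "v = (e \<bullet> v) *\<^sub>R e + y" by (simp add: y_def)
  show thesis
  proof (cases "y = 0")
    case True
    obtain w where "norm w = 1" "e \<bullet> w = 0" using exists_unit_orthogonal[OF assms(2)] .
    with v True show thesis using that[of "e \<bullet> v" 0 w] by simp
  next
    case False
    with v ey show thesis
      using that[of "e \<bullet> v" "norm y" "sgn y"] by (simp add: norm_sgn sgn_div_norm)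
  qed
qed

text \<open>
  The number \<open>c\<close> in the proof is the lower bound that the \<open>i\<close>-th eigenvalue has to satisfy. For \<open>i = 1\<close> the whole
  family of swept curves is needed; for larger \<open>i\<close> the ray \<open>b = 0\<close> suffices, together with
  the spherical bound on the tangential hyperplane.
\<close>

lemma ODE_imp_PDE:
  fixes U f :: "real \<Rightarrow> real"
  assumes N: "CARD('n::finite) \<ge> 2" and i: "i \<in> {1..CARD('n)}"
    and ODE: "visc_subsol_ODE CARD('n) i p f R U"
  shows "visc_subsol_PDE i p f R (\<lambda>x :: real ^ 'n. U (norm x))"
  unfolding visc_subsol_PDE_def
proof (intro allI impI ballI)
  fix \<Phi> and x :: "real ^ 'n"
  assume C2: "C2_on (punctured_ball R) \<Phi>" and x: "x \<in> punctured_ball R"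
    and max: "local_max_at (\<lambda>y. U (norm y) - \<Phi> y) x"
  define r where "r = norm x"
  define e where "e = sgn x"
  let ?H = "hessian \<Phi> x"
  define d where "d = gradient \<Phi> x \<bullet> e"
  define c where "c = \<bar>d\<bar> powr p - f r"
  have r: "0 < r" "r < R" using x by (auto simp: r_def punctured_ball_iff)
  then have e: "norm e = 1" by (auto simp: e_def r_def norm_sgn)
  then have ee: "e \<bullet> e = 1" and "e \<noteq> 0" by (auto simp: norm_eq_1)
  have N': "2 \<le> DIM(real ^ 'n)" using N by simp
  have sym: "transpose ?H = ?H" by (rule hessian_symmetric[OF C2 open_punctured_ball x])
  have tang: "gradient \<Phi> x \<bullet> w = 0" "d / r \<le> w \<bullet> (?H *v w)" if "norm w = 1" "e \<bullet> w = 0" for w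
    using spherical_test[OF C2 x max, of w] that by (simp_all add: e_def r_def d_def)
  have swept: "c \<le> lambda_bar CARD('n) i r
      ((e + b *\<^sub>R w) \<bullet> (?H *v (e + b *\<^sub>R w)) - b\<^sup>2 * (d / r)) d"
    if "norm w = 1" "e \<bullet> w = 0" for w b
    using swept_curve_test[OF ODE C2 x max, of w b] that by (simp add: e_def r_def d_def c_def)
  have grad: "norm (gradient \<Phi> x) = \<bar>d\<bar>"
  proof -
    obtain \<alpha> \<beta> w where g: "gradient \<Phi> x = \<alpha> *\<^sub>R e + \<beta> *\<^sub>R w" and w: "norm w = 1" "e \<bullet> w = 0"
      using radial_decomposition[OF e N'] .
    have "\<beta> = 0" using tang(1)[OF w] w by (auto simp: g inner_add_left)
    then show ?thesis using e ee by (simp add: d_def g)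
  qed
  have tangential: "d / r * (v \<bullet> v) \<le> v \<bullet> (?H *v v)" if "e \<bullet> v = 0" for v
  proof (cases "v = 0")
    case False
    have "d / r \<le> sgn v \<bullet> (?H *v sgn v)"
      using tang(2)[of "sgn v"] that False by (simp add: norm_sgn sgn_div_norm)
    moreover have "v \<bullet> (?H *v v) = (sgn v \<bullet> (?H *v sgn v)) * (v \<bullet> v)"
      using False by (simp add: sgn_div_norm matrix_vector_mult_scaleR dot_square_norm power2_eq_square field_simps)
    ultimately show ?thesis by (metis inner_ge_zero mult_right_mono)
  qed simp
  have hyperplane: "d / r \<le> ord_eigenvalue i ?H" if "2 \<le> i"
  proof (rule ord_eigenvalue_ge[OF sym subspace_hyperplane[of e] i])
    show "CARD('n) < dim {v. e \<bullet> v = 0} + i"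
      using that N \<open>e \<noteq> 0\<close> by (simp add: dim_hyperplane)
  qed (use tangential in simp)
  obtain w\<^sub>0 where w\<^sub>0: "norm w\<^sub>0 = 1" "e \<bullet> w\<^sub>0 = 0" using exists_unit_orthogonal[OF N'] .
  have radial: "c \<le> lambda_bar CARD('n) i r (e \<bullet> (?H *v e)) d"
    using swept[OF w\<^sub>0, of 0] by simp
  have "c \<le> ord_eigenvalue i ?H"
  proof -
    consider "i = 1" | "1 < i" "i < CARD('n)" | "1 < i" "i = CARD('n)" using i by fastforce
    then show ?thesis
    proof cases
      case 1
      have c: "c \<le> d / r" using radial by (simp add: lambda_bar_def 1)
      show ?thesis
      proof (rule ord_eigenvalue_ge[OF sym subspace_UNIV i])
        fix v :: "real ^ 'n"
        obtain \<alpha> \<beta> w where v: "v = \<alpha> *\<^sub>R e + \<beta> *\<^sub>R w" and w: "norm w = 1" "e \<bullet> w = 0"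
          using radial_decomposition[OF e N'] .
        have ww: "w \<bullet> w = 1" "w \<bullet> e = 0" using w by (simp_all add: norm_eq_1 inner_commute)
        show "c * (v \<bullet> v) \<le> v \<bullet> (?H *v v)"
        proof (cases "\<alpha> = 0")
          case True
          then have "e \<bullet> v = 0" using w by (simp add: v)
          with tangential c show ?thesis by (meson inner_ge_zero mult_right_mono order_trans)
        next
          case False
          define b where "b = \<beta> / \<alpha>"
          define y where "y = e + b *\<^sub>R w"
          have vy: "v = \<alpha> *\<^sub>R y" using False by (simp add: v y_def b_def scaleR_right_distrib)
          have "c \<le> y \<bullet> (?H *v y) - b\<^sup>2 * (d / r)"
            using swept[OF w, of b] by (simp add: lambda_bar_def 1 y_def)
          moreover have "c * b\<^sup>2 \<le> b\<^sup>2 * (d / r)"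
            using mult_left_mono[OF c, of "b\<^sup>2"] by (simp add: mult.commute)
          moreover have "y \<bullet> y = 1 + b\<^sup>2"
            using ee ww w by (simp add: y_def inner_add_left inner_add_right power2_eq_square)
          ultimately have "c * (y \<bullet> y) \<le> y \<bullet> (?H *v y)" by (simp add: algebra_simps)
          then have "\<alpha>\<^sup>2 * (c * (y \<bullet> y)) \<le> \<alpha>\<^sup>2 * (y \<bullet> (?H *v y))" by (simp add: mult_left_mono)
          then show ?thesis by (simp add: vy matrix_vector_mult_scaleR power2_eq_square ac_simps)
        qed
      qed (use i in simp)
    next
      case 2
      then show ?thesis using radial hyperplane by (simp add: lambda_bar_def)
    next
      case 3
      have "e \<bullet> (?H *v e) \<le> ord_eigenvalue i ?H"
      proof (rule ord_eigenvalue_ge[OF sym subspace_span[of "{e}"] i])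
        show "CARD('n) < dim (span {e}) + i"
          using 3 \<open>e \<noteq> 0\<close> by (simp add: dim_span dim_singleton)
        fix v assume "v \<in> span {e}"
        then obtain k where "v = k *\<^sub>R e" by (auto simp: span_singleton)
        then show "e \<bullet> (?H *v e) * (v \<bullet> v) \<le> v \<bullet> (?H *v v)"
          using ee by (simp add: matrix_vector_mult_scaleR)
      qed
      then show ?thesis using 3 radial hyperplane by (simp add: lambda_bar_def)
    qed
  qed
  then show "- ord_eigenvalue i ?H + norm (gradient \<Phi> x) powr p \<le> f (norm x)"
    unfolding grad by (simp add: c_def r_def)
qed

theorem proposition3p8:
  fixes U f :: "real \<Rightarrow> real" and p R :: real and i :: nat
  assumes "CARD('n::finite) \<ge> 2"
    and "i \<in> {1..CARD('n)}"
    and "p > 1"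
    and "R > 0"
    and "usc_on {0<..<R} U"
    and "continuous_on {0<..<R} f"
    and "locally_bounded_on {0<..<R} U"
  shows "visc_subsol_PDE i p f R (\<lambda>x :: real ^ 'n. U (norm x)) \<longleftrightarrow>
         visc_subsol_ODE CARD('n) i p f R U"
  using PDE_imp_ODE[OF assms(1,2)] ODE_imp_PDE[OF assms(1,2)] by blast

end
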